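(* Consider the $N$-player constrained dynamic game, the value functions $Z_t^i, V_t^i$ and the local feedback Stackelberg policies $\{\pi_t^i\}_{t=0,i=1}^{T,N}$ described in the context, and assume the regularity assumption stated there. Then for each $t\in\mathbf I_0^T$ and each $i\in\mathbf I_1^N$, the local feedback Stackelberg policy $\pi_t^i$ can be equivalently represented by a constrained optimization problem: given the current state $\bar x_t$ and the prior players' actions $\bar u_t^{1:i-1}$, choosing $\pi_t^i(\bar x_t,\bar u_t^{1:i-1})=\tilde u_t^i\in\arg\min_{u_t^i}Z_t^i(\bar x_t,\bar u_t^{1:i-1},u_t^i)$ is equivalent to choosing $\pi_t^i(\bar x_t,\bar u_t^{1:i-1})=\tilde u_t^i$ with $$\tilde u_t^i\in \underset{u_t^i}{\arg}\ \min_{u_t^{i:N},\,u_{t+1:T}^{1:N},\,x_{t+1:T+1}}\ \ell_t^i(\bar x_t,\bar u_t^{1:i-1},u_t^{i:N})+\sum_{\tau=t+1}^T\ell_\tau^i(x_\tau,u_\tau)+\ell_{T+1}^i(x_{T+1})$$ subject to $$\begin{aligned} &0=u_t^j-\pi_t^j(\bar x_t,\bar u_t^{1:i-1},u_t^{i:j-1}), && j\in\mathbf I_{i+1}^N,\\ &0=x_{t+1}-f_t(\bar x_t,\bar u_t^{1:i-1},u_t^{i:N}),\\ &0=h_t^i(\bar x_t,\bar u_t^{1:i-1},u_t^{i:N}),\quad 0\le g_t^i(\bar x_t,\bar u_t^{1:i-1},u_t^{i:N}),\\ &0=u_\tau^j-\pi_\tau^j(x_\tau,u_\tau^{1:j-1}),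 && \tau\in\mathbf I_{t+1}^T,\ j\in\mathbf I_1^N\setminus\{i\},\\ &0=x_{\tau+1}-f_\tau(x_\tau,u_\tau), && \tau\in\mathbf I_{t+1}^T,\\ &0=h_\tau^i(x_\tau,u_\tau),\quad 0\le g_\tau^i(x_\tau,u_\tau), && \tau\in\mathbf I_{t+1}^T,\\ &0=h_{T+1}^i(x_{T+1}),\quad 0\le g_{T+1}^i(x_{T+1}), \end{aligned}$$ where the first constraint is dropped when $i=N$, and the constraints indexed by $\tau\in\mathbf I_{t+1}^T$ are dropped when $t=T$. Here $\arg_u\min_{u,v}$ means that one minimizes over $(u,v)$ but returns only $u$.
   Context: Game. $\mathbf I_j^k=\{j,j+1,\dots,k\}$ if $j\le k$ and $\emptyset$ otherwise. There are $N$ players and a horizon $T\in\mathbb N$. At time $t$ the state is $x_t\in\mathbb R^n$, player $i$'s control is $u_t^i\in\mathbb R^{m_i}$, and $u_t=[u_t^1,\dots,u_t^N]\in\mathbb R^m$, $m=\sum_i m_i$. Write $u_{t:t'}^{i:i'}=\{u_\tau^j:\tau\in\mathbf I_t^{t'},j\in\mathbf I_i^{i'}\}$ (empty if an index range is empty) and $x_{t:t'}=(x_t,\dots,x_{t'})$. At each time players act in the order of their indices. Dynamics: $x_{t+1}=f_t(x_t,u_t)$, $t\in\mathbf I_0^T$. Player $i$ has stage costs $\ell_t^i(x_t,u_t)$, terminal cost $\ell_{T+1}^i(x_{T+1})$, constraints $0=h_t^i(x_t,u_t)\in\mathbb R^{n_{h,t}^i}$, $0\le g_t^i(x_t,u_t)\in\mathbb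 R^{n_{g,t}^i}$ for $t\in\mathbf I_0^T$, and terminal constraints $0=h_{T+1}^i(x_{T+1})$, $0\le g_{T+1}^i(x_{T+1})$. Regularity assumption. The feasible set $\mathcal F$ of all $(x_0,\dots,x_{T+1},u_0,\dots,u_T)$ satisfying the dynamics and all players' equality and inequality constraints at all times is compact; costs, dynamics and constraint functions are twice differentiable and bounded on $\mathcal F$ (possibly nonconvex). Policies. A policy of player $1$ at time $t$ is a map $\pi_t^1:\mathbb R^n\to\mathbb R^{m_1}$, $x_t\mapsto\pi_t^1(x_t)$; for $i\ge2$ it is a map $(x_t,u_t^{1:i-1})\mapsto\pi_t^i(x_t,u_t^{1:i-1})\in\mathbb R^{m_i}$. Value functions and local feedback Stackelberg policies are defined backward in time and in reverse player order: - $V_{T+1}^i(x_{T+1})=\ell_{T+1}^i(x_{T+1})$ if $0=h_{T+1}^i(x_{T+1})$ and $0\le g_{T+1}^i(x_{T+1})$, and $+\infty$ otherwise. - For $t\le T$: $Z_t^i(x_t,u_t^{1:i-1},u_t^i)=\ell_t^i(x_t,u_t)+V_{t+1}^i(x_{t+1})$ where $u_t^j=\pi_t^j(x_t,u_t^{1:j-1})$ for $j\in\mathbf I_{i+1}^N$ and $x_{t+1}=f_t(x_t,u_t)$, if $0=h_t^i(x_t,u_t)$ and $0\le g_t^i(x_t,u_t)$; and $+\infty$ otherwise. - $\pi_t^i(x_t,u_t^{1:i-1}):=u_t^{i*}\in\arg\min_{\tilde u_t^i}Z_t^i(x_t,u_t^{1:i-1},\tilde u_t^i)$, where an arbitrary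 local minimizer is picked (for $i=1$ the argument $u_t^{1:0}$ is empty). - $V_t^i(x_t)=Z_t^i(x_t,u_t^{1*},\dots,u_t^{i*})$ with $u_t^{j*}=\pi_t^j(x_t,u_t^{1:(j-1)*})$, $j\in\mathbf I_1^i$. The symbol $\arg\min$ is used in the claim in the same sense as in this definition of the policies.
   Formalization: Proved for global minimizers throughout, and for local ones with the joint problem's own later controls of player i confined to small neighbourhoods of the policy's actions; with plain local minimizers of the joint problem the claim is false (a later double-well cost is a counterexample). *)

theory Defs
  imports "HOL-Analysis.Analysis"
begin

text \<open>
  The joint control space is \<open>real ^ 'm\<close>, and \<open>owner\<close> tells which player a coordinate belongs to,
  so player \<open>i\<close> has \<open>m\<^sub>i = card {k. owner k = i}\<close> control coordinates. Sub-vectors such as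
  \<open>u\<^sup>i\<close> or the actions of players \<open>1, ..., i - 1\<close> are zero-padded to \<open>real ^ 'm\<close>; concatenating
  the actions of disjoint groups of players is then addition.
  The constraint maps have a varying number of components and are given componentwise.
\<close>

record ('n::finite, 'm::finite) dyn_game =
  num_players :: nat
  horizon :: nat
  owner :: "'m \<Rightarrow> nat"
  dyn :: "nat \<Rightarrow> (real ^ 'n) \<times> (real ^ 'm) \<Rightarrow> real ^ 'n"
  cost :: "nat \<Rightarrow> nat \<Rightarrow> (real ^ 'n) \<times> (real ^ 'm) \<Rightarrow> real"
  tcost :: "nat \<Rightarrow> real ^ 'n \<Rightarrow> real"
  eq_dim :: "nat \<Rightarrow> nat \<Rightarrow> nat"
  eq_con :: "nat \<Rightarrow> nat \<Rightarrow> nat \<Rightarrow> (real ^ 'n) \<times> (real ^ 'm) \<Rightarrow> real"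
  ineq_dim :: "nat \<Rightarrow> nat \<Rightarrow> nat"
  ineq_con :: "nat \<Rightarrow> nat \<Rightarrow> nat \<Rightarrow> (real ^ 'n) \<times> (real ^ 'm) \<Rightarrow> real"
  teq_dim :: "nat \<Rightarrow> nat"
  teq_con :: "nat \<Rightarrow> nat \<Rightarrow> real ^ 'n \<Rightarrow> real"
  tineq_dim :: "nat \<Rightarrow> nat"
  tineq_con :: "nat \<Rightarrow> nat \<Rightarrow> real ^ 'n \<Rightarrow> real"

text \<open>
  Throughout, \<open>t\<close> and \<open>\<tau>\<close> are times and \<open>i\<close>, \<open>j\<close> players, with the time argument first;
  \<open>\<pi> t i x v\<close> is the action of player \<open>i\<close> when the players before \<open>i\<close> have played \<open>v\<close>.
\<close>

type_synonym ('n, 'm) policy = "nat \<Rightarrow> nat \<Rightarrow> real ^ 'n \<Rightarrow> real ^ 'm \<Rightarrow> real ^ 'm"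

definition players :: "('n::finite, 'm::finite) dyn_game \<Rightarrow> nat set" where
  "players G = {1..num_players G}"

definition well_formed :: "('n::finite, 'm::finite) dyn_game \<Rightarrow> bool" where
  "well_formed G \<longleftrightarrow> range (owner G) \<subseteq> players G"

definition ctrl :: "('n::finite, 'm::finite) dyn_game \<Rightarrow> nat set \<Rightarrow> (real ^ 'm) set" where
  "ctrl G J = {u. \<forall>k. owner G k \<notin> J \<longrightarrow> u $ k = 0}"

definition proj :: "('n::finite, 'm::finite) dyn_game \<Rightarrow> nat set \<Rightarrow> real ^ 'm \<Rightarrow> real ^ 'm" where
  "proj G J u = (\<chi> k. if owner G k \<in> J then u $ k else 0)"

definition stage_ok ::
  "('n::finite, 'm::finite) dyn_game \<Rightarrow> nat \<Rightarrow> nat \<Rightarrow> (real ^ 'n) \<times> (real ^ 'm) \<Rightarrow> bool" where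
  "stage_ok G t i p \<longleftrightarrow>
     (\<forall>k < eq_dim G t i. 0 = eq_con G t i k p) \<and> (\<forall>k < ineq_dim G t i. 0 \<le> ineq_con G t i k p)"

definition terminal_ok :: "('n::finite, 'm::finite) dyn_game \<Rightarrow> nat \<Rightarrow> real ^ 'n \<Rightarrow> bool" where
  "terminal_ok G i x \<longleftrightarrow>
     (\<forall>k < teq_dim G i. 0 = teq_con G i k x) \<and> (\<forall>k < tineq_dim G i. 0 \<le> tineq_con G i k x)"


text \<open>
  Trajectories are set to zero outside their index ranges, so that the product topology on
  functions from \<open>nat\<close> induces the Euclidean topology on them.
\<close>

definition feasible_set ::
  "('n::finite, 'm::finite) dyn_game \<Rightarrow> ((nat \<Rightarrow> real ^ 'n) \<times> (nat \<Rightarrow> real ^ 'm)) set" where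
  "feasible_set G = {(X, U).
     (\<forall>t \<le> horizon G. X (Suc t) = dyn G t (X t, U t)) \<and>
     (\<forall>t \<le> horizon G. \<forall>i \<in> players G. stage_ok G t i (X t, U t)) \<and>
     (\<forall>i \<in> players G. terminal_ok G i (X (Suc (horizon G)))) \<and>
     (\<forall>t > Suc (horizon G). X t = 0) \<and> (\<forall>t > horizon G. U t = 0)}"

definition twice_differentiable_at ::
  "('a::real_normed_vector \<Rightarrow> 'b::real_normed_vector) \<Rightarrow> 'a \<Rightarrow> bool" where
  "twice_differentiable_at f p \<longleftrightarrow>
     (\<exists>f' :: 'a \<Rightarrow> 'a \<Rightarrow>\<^sub>L 'b.
        (\<forall>\<^sub>F y in nhds p. (f has_derivative blinfun_apply (f' y)) (at y)) \<and> f' differentiable (at p))"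

definition regular_on ::
  "'a set \<Rightarrow> ('a::real_normed_vector \<Rightarrow> 'b::real_normed_vector) \<Rightarrow> bool" where
  "regular_on S f \<longleftrightarrow> (\<forall>p \<in> S. twice_differentiable_at f p) \<and> bounded (f ` S)"

definition regular_game :: "('n::finite, 'm::finite) dyn_game \<Rightarrow> bool" where
  "regular_game G \<longleftrightarrow>
     compact (feasible_set G) \<and>
     (\<forall>t \<le> horizon G. let S = (\<lambda>(X, U). (X t, U t)) ` feasible_set G in
        regular_on S (dyn G t) \<and>
        (\<forall>i \<in> players G.
           regular_on S (cost G t i) \<and>
           (\<forall>k < eq_dim G t i. regular_on S (eq_con G t i k)) \<and>
           (\<forall>k < ineq_dim G t i. regular_on S (ineq_con G t i k)))) \<and>
     (let S = (\<lambda>(X, U). X (Suc (horizon G))) ` feasible_set G in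
        \<forall>i \<in> players G.
          regular_on S (tcost G i) \<and>
          (\<forall>k < teq_dim G i. regular_on S (teq_con G i k)) \<and>
          (\<forall>k < tineq_dim G i. regular_on S (tineq_con G i k)))"


text \<open>
  \<open>play \<pi> t x a b v\<close> extends the actions \<open>v\<close> of players \<open>1, ..., a - 1\<close> by the actions of players
  \<open>a, ..., b\<close>, who in turn observe what has been played so far and follow \<open>\<pi>\<close>.
\<close>

definition play ::
  "('n::finite, 'm::finite) policy \<Rightarrow> nat \<Rightarrow> real ^ 'n \<Rightarrow> nat \<Rightarrow> nat \<Rightarrow> real ^ 'm \<Rightarrow> real ^ 'm" where
  "play \<pi> t x a b v = fold (\<lambda>j u. u + \<pi> t j x u) [a..<Suc b] v"

function
  Z :: "('n::finite, 'm::finite) dyn_game \<Rightarrow> ('n, 'm) policy \<Rightarrow> nat \<Rightarrow> nat \<Rightarrow>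
          real ^ 'n \<Rightarrow> real ^ 'm \<Rightarrow> real ^ 'm \<Rightarrow> ereal" and
  V :: "('n, 'm) dyn_game \<Rightarrow> ('n, 'm) policy \<Rightarrow> nat \<Rightarrow> nat \<Rightarrow> real ^ 'n \<Rightarrow> ereal" where
  "Z G \<pi> t i x v w =
     (let u = play \<pi> t x (Suc i) (num_players G) (v + w) in
      if t \<le> horizon G \<and> stage_ok G t i (x, u)
      then ereal (cost G t i (x, u)) + V G \<pi> (Suc t) i (dyn G t (x, u))
      else \<infinity>)"
| "V G \<pi> t i x =
     (if t \<le> horizon G
      then let v = play \<pi> t x 1 (i - 1) 0 in Z G \<pi> t i x v (\<pi> t i x v)
      else if terminal_ok G i x then ereal (tcost G i x) else \<infinity>)"
  by pat_completeness auto
termination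
  by (relation "Wellfounded.measure (\<lambda>s. case s of
        Inl (G, \<pi>, t, i, x, v, w) \<Rightarrow> 2 * (Suc (horizon G) - t)
      | Inr (G, \<pi>, t, i, x) \<Rightarrow> 2 * (Suc (horizon G) - t) + 1)") auto

declare Z.simps [simp del] V.simps [simp del]

text \<open>
  A constant function \<open>\<infinity>\<close> is minimized everywhere; hence a policy is unconstrained at a point where
  player \<open>i\<close>'s problem is infeasible. \<open>S\<close> is a neighbourhood of \<open>w\<close> within \<open>D\<close>.
\<close>

definition is_local_arg_min :: "('a::topological_space \<Rightarrow> ereal) \<Rightarrow> 'a set \<Rightarrow> 'a \<Rightarrow> bool" where
  "is_local_arg_min F D w \<longleftrightarrow>
     (\<exists>S. openin (top_of_set D) S \<and> is_arg_min F (\<lambda>w'. w' \<in> S) w)"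

definition global_stackelberg ::
  "('n::finite, 'm::finite) dyn_game \<Rightarrow> ('n, 'm) policy \<Rightarrow> bool" where
  "global_stackelberg G \<pi> \<longleftrightarrow>
     (\<forall>t \<le> horizon G. \<forall>i \<in> players G. \<forall>x. \<forall>v \<in> ctrl G {1..<i}.
        is_arg_min (Z G \<pi> t i x v) (\<lambda>w. w \<in> ctrl G {i}) (\<pi> t i x v))"

definition local_stackelberg ::
  "('n::finite, 'm::finite) dyn_game \<Rightarrow> ('n, 'm) policy \<Rightarrow> bool" where
  "local_stackelberg G \<pi> \<longleftrightarrow>
     (\<forall>t \<le> horizon G. \<forall>i \<in> players G. \<forall>x. \<forall>v \<in> ctrl G {1..<i}.
        is_local_arg_min (Z G \<pi> t i x v) (ctrl G {i}) (\<pi> t i x v))"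


text \<open>
  The decision variables are \<open>(w, U, X)\<close>: \<open>w\<close> collects the actions of players \<open>i, ..., N\<close> at time \<open>t\<close>,
  \<open>U\<close> the controls at times \<open>t + 1, ..., T\<close> and \<open>X\<close> the states at times \<open>t + 1, ..., T + 1\<close>.
\<close>

type_synonym ('n, 'm) decision =
  "(real ^ 'm) \<times> (nat \<Rightarrow> real ^ 'm) \<times> (nat \<Rightarrow> real ^ 'n)"

definition decisions ::
  "('n::finite, 'm::finite) dyn_game \<Rightarrow> nat \<Rightarrow> nat \<Rightarrow> ('n, 'm) decision set" where
  "decisions G t i =
     ctrl G {i..num_players G} \<times>
     ({Suc t..horizon G} \<rightarrow>\<^sub>E UNIV) \<times> ({Suc t..Suc (horizon G)} \<rightarrow>\<^sub>E UNIV)"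

definition objective ::
  "('n::finite, 'm::finite) dyn_game \<Rightarrow> nat \<Rightarrow> nat \<Rightarrow> real ^ 'n \<Rightarrow> real ^ 'm \<Rightarrow>
     ('n, 'm) decision \<Rightarrow> real" where
  "objective G t i x v = (\<lambda>(w, U, X).
     cost G t i (x, v + w) + (\<Sum>\<tau> = Suc t..horizon G. cost G \<tau> i (X \<tau>, U \<tau>)) +
     tcost G i (X (Suc (horizon G))))"

definition satisfies_constraints ::
  "('n::finite, 'm::finite) dyn_game \<Rightarrow> ('n, 'm) policy \<Rightarrow> nat \<Rightarrow> nat \<Rightarrow> real ^ 'n \<Rightarrow> real ^ 'm \<Rightarrow>
     ('n, 'm) decision \<Rightarrow> bool" where
  "satisfies_constraints G \<pi> t i x v = (\<lambda>(w, U, X).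
     (\<forall>j \<in> {Suc i..num_players G}. 0 = proj G {j} w - \<pi> t j x (v + proj G {i..<j} w)) \<and>
     0 = X (Suc t) - dyn G t (x, v + w) \<and>
     stage_ok G t i (x, v + w) \<and>
     (\<forall>\<tau> \<in> {Suc t..horizon G}. \<forall>j \<in> players G - {i}.
        0 = proj G {j} (U \<tau>) - \<pi> \<tau> j (X \<tau>) (proj G {1..<j} (U \<tau>))) \<and>
     (\<forall>\<tau> \<in> {Suc t..horizon G}. 0 = X (Suc \<tau>) - dyn G \<tau> (X \<tau>, U \<tau>)) \<and>
     (\<forall>\<tau> \<in> {Suc t..horizon G}. stage_ok G \<tau> i (X \<tau>, U \<tau>)) \<and>
     terminal_ok G i (X (Suc (horizon G))))"

text \<open>
  As for \<open>Z\<close>, violated constraints count as cost \<open>\<infinity>\<close>: if some feasible decision is available, the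
  minimizers are exactly the feasible decisions of least objective (see below), and otherwise
  all decisions are minimizers.
\<close>

definition constrained_cost ::
  "('n::finite, 'm::finite) dyn_game \<Rightarrow> ('n, 'm) policy \<Rightarrow> nat \<Rightarrow> nat \<Rightarrow> real ^ 'n \<Rightarrow> real ^ 'm \<Rightarrow>
     ('n, 'm) decision \<Rightarrow> ereal" where
  "constrained_cost G \<pi> t i x v y =
     (if satisfies_constraints G \<pi> t i x v y then ereal (objective G t i x v y) else \<infinity>)"

lemma is_arg_min_constrained_cost:
  assumes "y0 \<in> D" "satisfies_constraints G \<pi> t i x v y0"
  shows "is_arg_min (constrained_cost G \<pi> t i x v) (\<lambda>y. y \<in> D) y \<longleftrightarrow>
         is_arg_min (objective G t i x v) (\<lambda>y. y \<in> D \<and> satisfies_constraints G \<pi> t i x v y) y"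
  using assms unfolding is_arg_min_def constrained_cost_def
  by (auto split: if_splits simp del: split_paired_Ex split_paired_All)

text \<open>
  Local minimality in the joint problem. The controls player \<open>i\<close> is free to choose are the one at time
  \<open>t\<close> and its own later ones; the latter range over neighbourhoods \<open>R\<close> of the actions of the
  policy that enters \<open>V\<close>. A neighbourhood in the space of all decisions would not do: it may surround
  another local minimizer of a later stage than the one picked by \<open>\<pi>\<close> (whose value need not even be
  continuous), and then the equivalence with local minimality of \<open>Z\<close> is false.
\<close>

definition neighbourhoods ::
  "('n::finite, 'm::finite) dyn_game \<Rightarrow> ('n, 'm) policy \<Rightarrow>
     (nat \<Rightarrow> nat \<Rightarrow> real ^ 'n \<Rightarrow> real ^ 'm \<Rightarrow> (real ^ 'm) set) \<Rightarrow> bool" where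
  "neighbourhoods G \<pi> R \<longleftrightarrow>
     (\<forall>t \<le> horizon G. \<forall>i \<in> players G. \<forall>x. \<forall>v \<in> ctrl G {1..<i}.
        openin (top_of_set (ctrl G {i})) (R t i x v) \<and> \<pi> t i x v \<in> R t i x v)"

definition decisions_within ::
  "('n::finite, 'm::finite) dyn_game \<Rightarrow> nat \<Rightarrow> nat \<Rightarrow> (real ^ 'm) set \<Rightarrow>
     (nat \<Rightarrow> nat \<Rightarrow> real ^ 'n \<Rightarrow> real ^ 'm \<Rightarrow> (real ^ 'm) set) \<Rightarrow> ('n, 'm) decision set" where
  "decisions_within G t i S R = {(w, U, X) \<in> decisions G t i.
     proj G {i} w \<in> S \<and>
     (\<forall>\<tau> \<in> {Suc t..horizon G}. proj G {i} (U \<tau>) \<in> R \<tau> i (X \<tau>) (proj G {1..<i} (U \<tau>)))}"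

end

(* Follow the policies from the state and actions at hand: the resulting decision has a constrained
   cost equal to Z. Any other decision that is feasible for player i differs from it only in
   the later actions of player i, and backward induction on Bellman's equation shows that its cost is
   at least Z, since the policy action minimizes Z over every admitted action. So Z is the partial
   minimum of the constrained cost and the minimum is attained, whence minimizers correspond. *)

theory Submission
  imports Defs
begin

section \<open>Zero-padded controls and projections onto groups of players\<close>

lemma proj_in_ctrl: "proj G J u \<in> ctrl G J"
  by (simp add: proj_def ctrl_def)

lemma proj_ident: "u \<in> ctrl G J \<Longrightarrow> proj G J u = u"
  by (auto simp: proj_def ctrl_def vec_eq_iff)

lemma proj_zero: "u \<in> ctrl G J \<Longrightarrow> J \<inter> K = {} \<Longrightarrow> proj G K u = 0"
  by (auto simp: proj_def ctrl_def vec_eq_iff)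

lemma proj_empty: "proj G {} u = 0"
  by (simp add: proj_def vec_eq_iff)

lemma proj_add: "proj G J (u + v) = proj G J u + proj G J v"
  by (auto simp: proj_def vec_eq_iff)

lemma proj_proj: "proj G J (proj G K u) = proj G (J \<inter> K) u"
  by (auto simp: proj_def vec_eq_iff)

lemma proj_union: "J \<inter> K = {} \<Longrightarrow> proj G (J \<union> K) u = proj G J u + proj G K u"
  by (auto simp: proj_def vec_eq_iff)

lemma ctrl_mono: "u \<in> ctrl G J \<Longrightarrow> J \<subseteq> K \<Longrightarrow> u \<in> ctrl G K"
  by (auto simp: ctrl_def)

lemma ctrl_add: "u \<in> ctrl G J \<Longrightarrow> v \<in> ctrl G J \<Longrightarrow> u + v \<in> ctrl G J"
  by (auto simp: ctrl_def)

lemma ctrl_zero: "0 \<in> ctrl G J"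
  by (simp add: ctrl_def)

text \<open>By \<open>well_formed\<close> every coordinate is owned by some player, so the
  projection loses nothing. The half-open interval matches \<open>{1..<j}\<close>, the players whom
  \<open>j\<close> observes.\<close>

lemma proj_all: "well_formed G \<Longrightarrow> proj G {1..<Suc (num_players G)} u = u"
  by (rule proj_ident)
    (simp add: ctrl_def well_formed_def players_def image_subset_iff atLeastLessThanSuc_atLeastAtMost)

lemma proj_lessThan_Suc: "1 \<le> b \<Longrightarrow> proj G {1..<Suc b} u = proj G {1..<b} u + proj G {b} u"
proof -
  assume "1 \<le> b"
  then have "{1..<Suc b} = {1..<b} \<union> {b}" by auto
  then show ?thesis using proj_union[of "{1..<b}" "{b}"] by simp
qed

section \<open>Sequential play within one stage\<close>

lemma play_empty: "play \<pi> t x (Suc b) b v = v"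
  by (simp add: play_def)

lemma play_Suc:
  "a \<le> Suc b \<Longrightarrow>
   play \<pi> t x a (Suc b) v = play \<pi> t x a b v + \<pi> t (Suc b) x (play \<pi> t x a b v)"
  by (simp add: play_def)

lemma play_split:
  assumes "a \<le> Suc b" "b \<le> c"
  shows "play \<pi> t x (Suc b) c (play \<pi> t x a b v) = play \<pi> t x a c v"
proof -
  have "[a..<Suc c] = [a..<Suc b] @ [Suc b..<Suc c]"
    using assms upt_add_eq_append[of a "Suc b" "c - b"] by simp
  then show ?thesis by (simp add: play_def)
qed

text \<open>What global and local optimality have in common: an action occupies only the coordinates
  of the player who takes it. Feasibility arguments start from this, so that both cases share
  them.\<close>

definition admissible ::
  "('n::finite, 'm::finite) dyn_game \<Rightarrow> ('n, 'm) policy \<Rightarrow> bool" where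
  "admissible G \<pi> \<longleftrightarrow>
     (\<forall>t \<le> horizon G. \<forall>i \<in> players G. \<forall>x. \<forall>v \<in> ctrl G {1..<i}. \<pi> t i x v \<in> ctrl G {i})"

lemma admissibleD:
  "admissible G \<pi> \<Longrightarrow> t \<le> horizon G \<Longrightarrow> 1 \<le> i \<Longrightarrow> i \<le> num_players G \<Longrightarrow> v \<in> ctrl G {1..<i} \<Longrightarrow>
   \<pi> t i x v \<in> ctrl G {i}"
  by (auto simp: admissible_def players_def)

lemma global_stackelberg_admissible: "global_stackelberg G \<pi> \<Longrightarrow> admissible G \<pi>"
  by (auto simp: global_stackelberg_def admissible_def is_arg_min_def)

lemma local_stackelberg_admissible: "local_stackelberg G \<pi> \<Longrightarrow> admissible G \<pi>"
  unfolding local_stackelberg_def admissible_def is_local_arg_min_def is_arg_min_def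
  by (meson openin_imp_subset subsetD)

text \<open>The constraints of the joint problem describe policies implicitly, by equations on a
  given control vector, while \<open>play\<close> computes the actions. The next two lemmas identify
  \<open>play\<close> as the unique solution of these equations for given earlier actions.\<close>

definition follows ::
  "('n::finite, 'm::finite) dyn_game \<Rightarrow> ('n, 'm) policy \<Rightarrow> nat \<Rightarrow> real ^ 'n \<Rightarrow> nat \<Rightarrow> nat \<Rightarrow>
     real ^ 'm \<Rightarrow> bool" where
  "follows G \<pi> t x a b u \<longleftrightarrow> (\<forall>j \<in> {a..b}. proj G {j} u = \<pi> t j x (proj G {1..<j} u))"

text \<open>Existence, by induction on the last player: each new action enters coordinates that were
  zero before, so the equations of the earlier players persist.\<close>

lemma play_follows:
  assumes "admissible G \<pi>" "t \<le> horizon G" "1 \<le> a" "a \<le> Suc b" "b \<le> num_players G"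
    and "v \<in> ctrl G {1..<a}"
  shows "play \<pi> t x a b v \<in> ctrl G {1..<Suc b} \<and> proj G {1..<a} (play \<pi> t x a b v) = v \<and>
    follows G \<pi> t x a b (play \<pi> t x a b v)"
  using assms(4,5)
proof (induction b)
  case 0
  \<comment> \<open>The bound \<open>a \<le> Suc b\<close> admits an empty range of players; for
    \<open>b = 0\<close> it is the only possibility.\<close>
  then have "a = Suc 0" using assms(3) by simp
  then show ?case using assms(6) by (simp add: play_empty proj_ident follows_def)
next
  case (Suc b)
  show ?case
  proof (cases "a = Suc (Suc b)")
    case True
    then show ?thesis using assms(6) by (simp add: play_empty proj_ident follows_def)
  next
    case False
    then have le: "a \<le> Suc b" using Suc.prems by simp
    define u where "u = play \<pi> t x a b v"
    define p where "p = \<pi> t (Suc b) x u"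
    have IH: "u \<in> ctrl G {1..<Suc b}" "proj G {1..<a} u = v" "follows G \<pi> t x a b u"
      using Suc.IH[OF le] Suc.prems by (auto simp: u_def)
    have p: "p \<in> ctrl G {Suc b}"
      unfolding p_def using assms(1,2) Suc.prems IH(1) by (intro admissibleD) auto
    have eq: "play \<pi> t x a (Suc b) v = u + p"
      by (simp add: play_Suc le u_def p_def)
    have 1: "u + p \<in> ctrl G {1..<Suc (Suc b)}"
      by (intro ctrl_add ctrl_mono[OF IH(1)] ctrl_mono[OF p]) auto
    \<comment> \<open>The action \<open>p\<close> vanishes on the coordinates of all players up to
      \<open>b\<close>.\<close>
    have early: "proj G J (u + p) = proj G J u" if "J \<subseteq> {1..<Suc b}" for J
      using that by (subst proj_add, subst proj_zero[OF p]) auto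
    have "proj G {Suc b} (u + p) = p"
      by (subst proj_add, subst proj_zero[OF IH(1)]) (auto simp: proj_ident[OF p])
    moreover have "proj G {1..<Suc b} (u + p) = u"
      by (simp add: early proj_ident[OF IH(1)] del: One_nat_def)
    ultimately have last: "proj G {Suc b} (u + p) = \<pi> t (Suc b) x (proj G {1..<Suc b} (u + p))"
      by (simp add: p_def)
    have "proj G {j} (u + p) = \<pi> t j x (proj G {1..<j} (u + p))" if "j \<in> {a..b}" for j
    proof -
      have "proj G {j} (u + p) = proj G {j} u" "proj G {1..<j} (u + p) = proj G {1..<j} u"
        using that assms(3) by (auto intro!: early)
      then show ?thesis using IH(3) that by (simp add: follows_def)
    qed
    then have "follows G \<pi> t x a (Suc b) (u + p)"
      using last by (auto simp: follows_def le_Suc_eq)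
    moreover have "proj G {1..<a} (u + p) = v"
      using early[of "{1..<a}"] le IH(2) by auto
    ultimately show ?thesis using 1 eq by simp
  qed
qed

text \<open>Uniqueness: each equation determines one player's coordinates from those of the players
  before, so \<open>u\<close> is recovered player by player.\<close>

lemma play_unique:
  assumes "1 \<le> a" "a \<le> Suc b" "follows G \<pi> t x a b u"
  shows "play \<pi> t x a b (proj G {1..<a} u) = proj G {1..<Suc b} u"
  using assms(2,3)
proof (induction b)
  case 0
  then have "a = Suc 0" using assms(1) by simp
  then show ?case by (simp add: play_empty)
next
  case (Suc b)
  show ?case
  proof (cases "a = Suc (Suc b)")
    case True
    then show ?thesis by (simp add: play_empty)
  next
    case False
    then have le: "a \<le> Suc b" using Suc.prems by simp
    have "follows G \<pi> t x a b u" "proj G {Suc b} u = \<pi> t (Suc b) x (proj G {1..<Suc b} u)"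
      using Suc.prems le by (auto simp: follows_def)
    then show ?thesis
      using Suc.IH[OF le] by (simp add: play_Suc le proj_lessThan_Suc del: One_nat_def)
  qed
qed

lemma play_all_unique:
  assumes "well_formed G" "1 \<le> a" "a \<le> Suc (num_players G)"
    and "follows G \<pi> t x a (num_players G) u"
  shows "play \<pi> t x a (num_players G) (proj G {1..<a} u) = u"
  using play_unique[OF assms(2-4)] proj_all[OF assms(1)] by simp

section \<open>Value functions along trajectories\<close>

abbreviation joint :: "('n::finite, 'm::finite) dyn_game \<Rightarrow> ('n, 'm) policy \<Rightarrow> nat \<Rightarrow> real ^ 'n \<Rightarrow>
    real ^ 'm" where
  "joint G \<pi> t x \<equiv> play \<pi> t x 1 (num_players G) 0"

lemma joint_follows:
  assumes "admissible G \<pi>" "t \<le> horizon G"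
  shows "follows G \<pi> t x 1 (num_players G) (joint G \<pi> t x)"
  using play_follows[OF assms, of 1 "num_players G" 0] by (simp add: ctrl_zero)

lemma V_terminal: "V G \<pi> (Suc (horizon G)) i x = (if terminal_ok G i x then ereal (tcost G i x) else \<infinity>)"
  by (simp add: V.simps)

text \<open>In \<open>V\<close>, play is cut at player \<open>i\<close>: those before,
  \<open>i\<close> itself, those after. Glued together, the three pieces are joint play, the same
  for every \<open>i\<close>.\<close>

lemma V_stage:
  assumes "t \<le> horizon G" "i \<in> players G"
  shows "V G \<pi> t i x =
    (if stage_ok G t i (x, joint G \<pi> t x)
     then ereal (cost G t i (x, joint G \<pi> t x)) + V G \<pi> (Suc t) i (dyn G t (x, joint G \<pi> t x))
     else \<infinity>)"
proof -
  \<comment> \<open>With \<open>i = Suc k\<close> the truncated \<open>i - 1\<close> in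
    \<open>V\<close> becomes \<open>k\<close>, and \<open>play_Suc\<close> adds the action of
    \<open>i\<close>.\<close>
  obtain k where k: "i = Suc k" "Suc k \<le> num_players G"
    using assms(2) by (cases i) (auto simp: players_def)
  have "play \<pi> t x (Suc i) (num_players G)
      (play \<pi> t x 1 (i - 1) 0 + \<pi> t i x (play \<pi> t x 1 (i - 1) 0)) = joint G \<pi> t x"
    using k play_Suc[of 1 k \<pi> t x 0] play_split[of 1 "Suc k" "num_players G" \<pi> t x 0] by simp
  then show ?thesis
    using assms(1) by (simp add: V.simps[of G \<pi> t] Z.simps Let_def)
qed

text \<open>Backward induction peels off one stage at a time; at \<open>s = Suc (horizon G)\<close>
  the range of stages is empty and only the terminal cost is left.\<close>

definition tail_cost ::
  "('n::finite, 'm::finite) dyn_game \<Rightarrow> nat \<Rightarrow> nat \<Rightarrow> (nat \<Rightarrow> real ^ 'm) \<Rightarrow> (nat \<Rightarrow> real ^ 'n) \<Rightarrow>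
     real" where
  "tail_cost G s i U X =
     (\<Sum>\<tau> = s..horizon G. cost G \<tau> i (X \<tau>, U \<tau>)) + tcost G i (X (Suc (horizon G)))"

definition tail_ok ::
  "('n::finite, 'm::finite) dyn_game \<Rightarrow> nat \<Rightarrow> nat \<Rightarrow> (nat \<Rightarrow> real ^ 'm) \<Rightarrow> (nat \<Rightarrow> real ^ 'n) \<Rightarrow>
     bool" where
  "tail_ok G s i U X \<longleftrightarrow>
     (\<forall>\<tau> \<in> {s..horizon G}. stage_ok G \<tau> i (X \<tau>, U \<tau>)) \<and> terminal_ok G i (X (Suc (horizon G)))"

text \<open>Kept apart from \<open>tail_ok\<close> because a path generated by the policies obeys
  the dynamics even where it violates the constraints of player \<open>i\<close>.\<close>

definition tail_dyn ::
  "('n::finite, 'm::finite) dyn_game \<Rightarrow> nat \<Rightarrow> (nat \<Rightarrow> real ^ 'm) \<Rightarrow> (nat \<Rightarrow> real ^ 'n) \<Rightarrow> bool" where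
  "tail_dyn G s U X \<longleftrightarrow> (\<forall>\<tau> \<in> {s..horizon G}. X (Suc \<tau>) = dyn G \<tau> (X \<tau>, U \<tau>))"

lemma tail_cost_step:
  "s \<le> horizon G \<Longrightarrow> tail_cost G s i U X = cost G s i (X s, U s) + tail_cost G (Suc s) i U X"
  by (simp add: tail_cost_def sum.atLeast_Suc_atMost)

lemma tail_ok_step:
  assumes "s \<le> horizon G"
  shows "tail_ok G s i U X \<longleftrightarrow> stage_ok G s i (X s, U s) \<and> tail_ok G (Suc s) i U X"
  using assms unfolding tail_ok_def by (metis atLeastAtMost_iff not_less_eq_eq order_antisym
      order_refl Suc_leD)

lemma tail_dyn_step:
  "s \<le> horizon G \<Longrightarrow>
   tail_dyn G s U X \<longleftrightarrow> X (Suc s) = dyn G s (X s, U s) \<and> tail_dyn G (Suc s) U X"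
  unfolding tail_dyn_def by (metis atLeastAtMost_iff not_less_eq_eq order_antisym
      order_refl Suc_leD)

text \<open>Bellman's recursion unrolled from the terminal time backwards. A single violated
  constraint turns the value into \<open>\<infinity>\<close>, since real stage costs are absorbed by
  \<open>\<infinity>\<close>.\<close>

lemma V_on_path:
  assumes "i \<in> players G" "s \<le> Suc (horizon G)"
    and "\<And>\<tau>. \<tau> \<in> {s..horizon G} \<Longrightarrow> U \<tau> = joint G \<pi> \<tau> (X \<tau>)" and "tail_dyn G s U X"
  shows "V G \<pi> s i (X s) = (if tail_ok G s i U X then ereal (tail_cost G s i U X) else \<infinity>)"
  using assms(2-4)
proof (induction s rule: inc_induct)
  case base
  show ?case by (simp add: V_terminal tail_ok_def tail_cost_def)
next
  case (step s)
  then have s: "s \<le> horizon G" by simp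
  have "U s = joint G \<pi> s (X s)" "X (Suc s) = dyn G s (X s, U s)" "tail_dyn G (Suc s) U X"
    using step.prems s by (auto simp: tail_dyn_step)
  moreover have "V G \<pi> (Suc s) i (X (Suc s)) =
      (if tail_ok G (Suc s) i U X then ereal (tail_cost G (Suc s) i U X) else \<infinity>)"
    using step.prems(1) calculation(3) by (intro step.IH) auto
  ultimately show ?case
    using V_stage[OF s assms(1), of \<pi> "X s"]
    by (auto simp: tail_ok_step[OF s] tail_cost_step[OF s])
qed

text \<open>The reactions of the players after \<open>i\<close> are unique, so the control vector
  computed inside \<open>Z\<close> is any \<open>u\<close> that satisfies their equations. This is
  the form in which controls occur in the joint problem.\<close>

lemma Z_eq:
  assumes "well_formed G" "t \<le> horizon G" "i \<in> players G"
    and "follows G \<pi> t x (Suc i) (num_players G) u"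
  shows "Z G \<pi> t i x (proj G {1..<i} u) (proj G {i} u) =
    (if stage_ok G t i (x, u) then ereal (cost G t i (x, u)) + V G \<pi> (Suc t) i (dyn G t (x, u))
     else \<infinity>)"
proof -
  have "proj G {1..<i} u + proj G {i} u = proj G {1..<Suc i} u"
    using assms(3) by (intro proj_lessThan_Suc[symmetric]) (simp add: players_def)
  moreover have "play \<pi> t x (Suc i) (num_players G) (proj G {1..<Suc i} u) = u"
    using assms by (intro play_all_unique) (auto simp: players_def)
  ultimately show ?thesis
    using assms(2) by (simp add: Z.simps)
qed

text \<open>Here the optimality of the policy enters. The players before \<open>i\<close> follow
  their policies, so \<open>u\<close> and \<open>V\<close> agree on what \<open>i\<close> observes;
  then the policy action is compared with another action in \<open>R\<close>.\<close>

lemma V_le_Z: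
  assumes "admissible G \<pi>" "s \<le> horizon G" "i \<in> players G"
    and opt: "\<And>x v. v \<in> ctrl G {1..<i} \<Longrightarrow>
      is_arg_min (Z G \<pi> s i x v) (\<lambda>w. w \<in> R s i x v) (\<pi> s i x v)"
    and "follows G \<pi> s x 1 (i - 1) u" "proj G {i} u \<in> R s i x (proj G {1..<i} u)"
  shows "V G \<pi> s i x \<le> Z G \<pi> s i x (proj G {1..<i} u) (proj G {i} u)"
proof -
  have i: "1 \<le> i" "Suc (i - 1) = i" using assms(3) by (auto simp: players_def)
  \<comment> \<open>The start \<open>0\<close> of joint play is read as a projection onto nobody,
    which lets \<open>play_unique\<close> apply with \<open>a = 1\<close>.\<close>
  have "proj G {1..<1} u = 0" by (simp add: proj_empty)
  then have "play \<pi> s x 1 (i - 1) 0 = proj G {1..<i} u"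
    using play_unique[OF _ _ assms(5)] i by simp
  then have "V G \<pi> s i x = Z G \<pi> s i x (proj G {1..<i} u) (\<pi> s i x (proj G {1..<i} u))"
    using assms(2) by (simp add: V.simps[of G \<pi> s] Let_def)
  also have "\<dots> \<le> Z G \<pi> s i x (proj G {1..<i} u) (proj G {i} u)"
    using opt[OF proj_in_ctrl] assms(6) by (force simp: is_arg_min_def not_less)
  finally show ?thesis .
qed

text \<open>Verification by dynamic programming: player \<open>i\<close> may deviate within
  \<open>R\<close> at every stage while the others react. Deviations lead to states off the path of
  the policies, hence \<open>opt\<close> is assumed for all \<open>x\<close> and
  \<open>v\<close>.\<close>

lemma V_le_tail_cost:
  assumes "well_formed G" "admissible G \<pi>" "i \<in> players G" "s \<le> Suc (horizon G)"
    and opt: "\<And>\<tau> x v. \<tau> \<le> horizon G \<Longrightarrow> v \<in> ctrl G {1..<i} \<Longrightarrow>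
      is_arg_min (Z G \<pi> \<tau> i x v) (\<lambda>w. w \<in> R \<tau> i x v) (\<pi> \<tau> i x v)"
    and "\<And>\<tau> j. \<tau> \<in> {s..horizon G} \<Longrightarrow> j \<in> players G - {i} \<Longrightarrow>
      proj G {j} (U \<tau>) = \<pi> \<tau> j (X \<tau>) (proj G {1..<j} (U \<tau>))"
    and "\<And>\<tau>. \<tau> \<in> {s..horizon G} \<Longrightarrow> proj G {i} (U \<tau>) \<in> R \<tau> i (X \<tau>) (proj G {1..<i} (U \<tau>))"
    and "tail_dyn G s U X" "tail_ok G s i U X"
  shows "V G \<pi> s i (X s) \<le> ereal (tail_cost G s i U X)"
  using assms(4,6-9)
proof (induction s rule: inc_induct)
  case base
  then show ?case by (simp add: V_terminal tail_ok_def tail_cost_def)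
next
  case (step s)
  then have s: "s \<le> horizon G" by simp
  have others: "proj G {j} (U s) = \<pi> s j (X s) (proj G {1..<j} (U s))" if "j \<in> players G - {i}" for j
    using step.prems(1)[of s j] s that by simp
  have ok: "stage_ok G s i (X s, U s)" "tail_ok G (Suc s) i U X"
    "X (Suc s) = dyn G s (X s, U s)" "tail_dyn G (Suc s) U X"
    using step.prems(3,4) by (auto simp: tail_dyn_step[OF s] tail_ok_step[OF s])
  \<comment> \<open>Only the equation of player \<open>i\<close> is missing. Those before
    \<open>i\<close> serve to bound \<open>V\<close> by \<open>Z\<close>, those after
    \<open>i\<close> to evaluate \<open>Z\<close>.\<close>
  have "follows G \<pi> s (X s) 1 (i - 1) (U s)" "follows G \<pi> s (X s) (Suc i) (num_players G) (U s)"
    using others assms(3) unfolding follows_def players_def by fastforce+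
  note f = this
  have "V G \<pi> s i (X s) \<le> Z G \<pi> s i (X s) (proj G {1..<i} (U s)) (proj G {i} (U s))"
    using s step.prems(2)[of s] f by (intro V_le_Z[where R = R] assms(2,3) opt) auto
  also have "\<dots> = ereal (cost G s i (X s, U s)) + V G \<pi> (Suc s) i (X (Suc s))"
    using Z_eq[OF assms(1) s assms(3) f(2)] ok by simp
  also have "V G \<pi> (Suc s) i (X (Suc s)) \<le> ereal (tail_cost G (Suc s) i U X)"
    using step.prems(1,2) ok by (intro step.IH) auto
  finally show ?case
    by (simp add: tail_cost_step[OF s] add_left_mono)
qed

section \<open>The joint problem and its bound by \<open>Z\<close>\<close>

lemma objective_eq:
  "objective G t i x v (w, U, X) = cost G t i (x, v + w) + tail_cost G (Suc t) i U X"
  by (simp add: objective_def tail_cost_def)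

text \<open>Translates between the constraints, which separate the given \<open>v\<close> from the
  decided \<open>w\<close>, and \<open>follows\<close>, which speaks of the whole vector
  \<open>v + w\<close>.\<close>

lemma proj_add_early:
  assumes "v \<in> ctrl G {1..<i}" "w \<in> ctrl G {i..b}" "1 \<le> i" "i \<le> j"
  shows "proj G {j} (v + w) = proj G {j} w" "proj G {1..<j} (v + w) = v + proj G {i..<j} w"
proof -
  show "proj G {j} (v + w) = proj G {j} w"
    using assms by (subst proj_add, subst proj_zero[OF assms(1)]) auto
  have *: "{1..<j} = {1..<i} \<union> {i..<j}" using assms by auto
  have "proj G {1..<i} w = 0" "proj G {i..<j} v = 0"
    using assms by (auto intro!: proj_zero[OF assms(1)] proj_zero[OF assms(2)])
  then show "proj G {1..<j} (v + w) = v + proj G {i..<j} w"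
    unfolding * by (subst proj_union) (auto simp: proj_add proj_ident[OF assms(1)] simp del: One_nat_def)
qed

lemma follows_add:
  assumes "i \<in> players G" "v \<in> ctrl G {1..<i}" "w \<in> ctrl G {i..num_players G}"
  shows "follows G \<pi> t x (Suc i) (num_players G) (v + w) \<longleftrightarrow>
    (\<forall>j \<in> {Suc i..num_players G}. 0 = proj G {j} w - \<pi> t j x (v + proj G {i..<j} w))"
  using proj_add_early[OF assms(2,3)] assms(1) by (auto simp: follows_def players_def)

text \<open>For a feasible decision the stage at time \<open>t\<close> contributes the same cost to
  both sides; a gap can arise only from later actions of player \<open>i\<close>, where
  \<open>V_le_tail_cost\<close> applies.\<close>

lemma Z_le_constrained_cost:
  assumes "well_formed G" "admissible G \<pi>" "t \<le> horizon G" "i \<in> players G" "v \<in> ctrl G {1..<i}"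
    and opt: "\<And>\<tau> x v. \<tau> \<le> horizon G \<Longrightarrow> v \<in> ctrl G {1..<i} \<Longrightarrow>
      is_arg_min (Z G \<pi> \<tau> i x v) (\<lambda>w. w \<in> R \<tau> i x v) (\<pi> \<tau> i x v)"
    and y: "(w, U, X) \<in> decisions_within G t i S R"
  shows "Z G \<pi> t i x v (proj G {i} w) \<le> constrained_cost G \<pi> t i x v (w, U, X)"
proof (cases "satisfies_constraints G \<pi> t i x v (w, U, X)")
  case True
  have w: "w \<in> ctrl G {i..num_players G}" and i: "1 \<le> i"
    using y assms(4) by (auto simp: decisions_within_def decisions_def players_def)
  have f: "follows G \<pi> t x (Suc i) (num_players G) (v + w)"
    using True by (simp add: follows_add[OF assms(4,5) w] satisfies_constraints_def)
  have "V G \<pi> (Suc t) i (X (Suc t)) \<le> ereal (tail_cost G (Suc t) i U X)"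
    using True y assms(3)
    by (intro V_le_tail_cost[where R = R] assms opt)
      (auto simp: satisfies_constraints_def tail_dyn_def tail_ok_def decisions_within_def)
  \<comment> \<open>For \<open>j = i\<close> the range \<open>{i..<j}\<close> is empty, so the part
    of \<open>v + w\<close> before \<open>i\<close> is exactly \<open>v\<close>.\<close>
  moreover have "Z G \<pi> t i x v (proj G {i} w) =
      ereal (cost G t i (x, v + w)) + V G \<pi> (Suc t) i (X (Suc t))"
    using Z_eq[OF assms(1,3,4) f] proj_add_early[OF assms(5) w i order_refl] True
    by (simp add: satisfies_constraints_def proj_empty)
  ultimately show ?thesis
    using True by (simp add: constrained_cost_def objective_eq add_left_mono
        flip: plus_ereal.simps(1))
qed (simp add: constrained_cost_def)

text \<open>The states come from a recursion on the number of stages since \<open>s\<close>, cut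
  down to extensional functions. For \<open>s > Suc T\<close> they have no entry at
  \<open>s\<close>, hence the condition on the initial value.\<close>

lemma path_exists:
  "\<exists>U X. U \<in> {s..T} \<rightarrow>\<^sub>E UNIV \<and> X \<in> {s..Suc T} \<rightarrow>\<^sub>E UNIV \<and> (s \<le> Suc T \<longrightarrow> X s = \<xi>) \<and>
     (\<forall>\<tau> \<in> {s..T}. U \<tau> = p \<tau> (X \<tau>) \<and> X (Suc \<tau>) = f \<tau> (X \<tau>, U \<tau>))"
proof -
  define Y where "Y k = rec_nat \<xi> (\<lambda>k y. f (s + k) (y, p (s + k) y)) k" for k
  have Y: "Y 0 = \<xi>" "Y (Suc k) = f (s + k) (Y k, p (s + k) (Y k))" for k
    by (simp_all add: Y_def)
  show ?thesis
    by (rule exI[of _ "restrict (\<lambda>\<tau>. p \<tau> (Y (\<tau> - s))) {s..T}"],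
        rule exI[of _ "restrict (\<lambda>\<tau>. Y (\<tau> - s)) {s..Suc T}"])
      (auto simp: Y Suc_diff_le)
qed

text \<open>After \<open>a\<close> everybody, player \<open>i\<close> included, follows the
  policies. The equality covers infeasible cases too: dynamics and policy equations hold anyway, so
  both sides are \<open>\<infinity>\<close> under the same violations.\<close>

lemma Z_attained:
  assumes "well_formed G" "admissible G \<pi>" "t \<le> horizon G" "i \<in> players G" "v \<in> ctrl G {1..<i}"
    and R: "\<And>\<tau> x v. \<tau> \<le> horizon G \<Longrightarrow> v \<in> ctrl G {1..<i} \<Longrightarrow> \<pi> \<tau> i x v \<in> R \<tau> i x v"
    and a: "a \<in> S" "a \<in> ctrl G {i}"
  obtains w U X where "(w, U, X) \<in> decisions_within G t i S R" "proj G {i} w = a"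
    "constrained_cost G \<pi> t i x v (w, U, X) = Z G \<pi> t i x v a"
proof -
  let ?N = "num_players G"
  have i: "1 \<le> i" "i \<le> ?N" using assms(4) by (auto simp: players_def)
  have va: "v + a \<in> ctrl G {1..<Suc i}"
    using i by (intro ctrl_add ctrl_mono[OF assms(5)] ctrl_mono[OF a(2)]) auto
  define u where "u = play \<pi> t x (Suc i) ?N (v + a)"
  have u: "u \<in> ctrl G {1..<Suc ?N}" "proj G {1..<Suc i} u = v + a" "follows G \<pi> t x (Suc i) ?N u"
    using play_follows[OF assms(2,3) _ _ _ va, of ?N] i by (auto simp: u_def)
  \<comment> \<open>Only the actions from \<open>i\<close> on are decision variables; the remaining
    part of \<open>u\<close> is shown to be \<open>v\<close>.\<close>
  define w where "w = proj G {i..?N} u"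
  have w: "w \<in> ctrl G {i..?N}" by (simp add: w_def proj_in_ctrl)
  have va_i: "proj G {1..<i} (v + a) = v" "proj G {i} (v + a) = a"
    by (simp_all add: proj_add proj_ident[OF assms(5)] proj_ident[OF a(2)] proj_zero[OF assms(5)]
        proj_zero[OF a(2)] del: One_nat_def)
  have "{1..<i} \<inter> {1..<Suc i} = {1..<i}" "{i} \<inter> {1..<Suc i} = {i}" "{i} \<inter> {i..?N} = {i}"
    "{1..<Suc ?N} = {1..<i} \<union> {i..?N}"
    using i by auto
  note sets = this
  have uv: "proj G {1..<i} u = v" "proj G {i} u = a"
    using arg_cong[OF u(2), of "proj G {1..<i}"] arg_cong[OF u(2), of "proj G {i}"] va_i
    by (simp_all only: proj_proj sets)
  have uw: "v + w = u"
    using proj_all[OF assms(1), of u] proj_union[of "{1..<i}" "{i..?N}" G u] uv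
    by (simp only: sets w_def) (simp add: disjoint_iff)
  have wa: "proj G {i} w = a"
    unfolding w_def by (simp only: proj_proj sets uv)
  obtain U X where UX: "U \<in> {Suc t..horizon G} \<rightarrow>\<^sub>E UNIV" "X \<in> {Suc t..Suc (horizon G)} \<rightarrow>\<^sub>E UNIV"
    "X (Suc t) = dyn G t (x, u)"
    and path: "\<And>\<tau>. \<tau> \<in> {Suc t..horizon G} \<Longrightarrow>
      U \<tau> = joint G \<pi> \<tau> (X \<tau>) \<and> X (Suc \<tau>) = dyn G \<tau> (X \<tau>, U \<tau>)"
    using path_exists[of "Suc t" "horizon G" "dyn G t (x, u)" "joint G \<pi>" "dyn G"] assms(3) by auto
  have dyn: "tail_dyn G (Suc t) U X" using path by (simp add: tail_dyn_def)
  \<comment> \<open>For \<open>j = i\<close> this places the later actions of \<open>i\<close> in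
    \<open>R\<close>; for the other players it is their constraint.\<close>
  have UF: "proj G {j} (U \<tau>) = \<pi> \<tau> j (X \<tau>) (proj G {1..<j} (U \<tau>))"
    if "\<tau> \<in> {Suc t..horizon G}" "j \<in> players G" for \<tau> j
    using joint_follows[OF assms(2), of \<tau> "X \<tau>"] path[OF that(1)] that
    by (auto simp: follows_def players_def)
  have "(w, U, X) \<in> decisions_within G t i S R"
    using w UX wa a(1) UF assms(4) by (auto simp: decisions_within_def decisions_def proj_in_ctrl intro!: R)
  moreover have "constrained_cost G \<pi> t i x v (w, U, X) = Z G \<pi> t i x v a"
  proof -
    have "V G \<pi> (Suc t) i (X (Suc t)) =
        (if tail_ok G (Suc t) i U X then ereal (tail_cost G (Suc t) i U X) else \<infinity>)"
      using path dyn assms(3,4) by (intro V_on_path) auto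
    then have "Z G \<pi> t i x v a = (if stage_ok G t i (x, u) \<and> tail_ok G (Suc t) i U X
        then ereal (cost G t i (x, u) + tail_cost G (Suc t) i U X) else \<infinity>)"
      using Z_eq[OF assms(1,3,4) u(3)] uv UX(3) by simp
    moreover have "satisfies_constraints G \<pi> t i x v (w, U, X) \<longleftrightarrow>
        stage_ok G t i (x, u) \<and> tail_ok G (Suc t) i U X"
      using u(3)[folded uw, unfolded follows_add[OF assms(4,5) w]] UF path UX(3) uw
      by (auto simp: satisfies_constraints_def tail_ok_def)
    ultimately show ?thesis by (simp add: constrained_cost_def objective_eq uw)
  qed
  ultimately show thesis using wa that by blast
qed

text \<open>Partial minimization, with \<open>lower\<close> and \<open>attained\<close> as its two
  halves. The sets \<open>S\<close> and \<open>R\<close> are parameters to serve the global and the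
  local case alike; \<open>c\<close> records that the minimal values agree as well.\<close>

lemma arg_min_Z_iff:
  assumes "well_formed G" "admissible G \<pi>" "t \<le> horizon G" "i \<in> players G" "v \<in> ctrl G {1..<i}"
    and opt: "\<And>\<tau> x v. \<tau> \<le> horizon G \<Longrightarrow> v \<in> ctrl G {1..<i} \<Longrightarrow>
      is_arg_min (Z G \<pi> \<tau> i x v) (\<lambda>w. w \<in> R \<tau> i x v) (\<pi> \<tau> i x v)"
    and S: "S \<subseteq> ctrl G {i}"
  shows "is_arg_min (Z G \<pi> t i x v) (\<lambda>w. w \<in> S) a \<and> Z G \<pi> t i x v a = c \<longleftrightarrow>
    (\<exists>w U X. proj G {i} w = a \<and>
       is_arg_min (constrained_cost G \<pi> t i x v) (\<lambda>y. y \<in> decisions_within G t i S R) (w, U, X) \<and>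
       constrained_cost G \<pi> t i x v (w, U, X) = c)"
    (is "?L \<longleftrightarrow> ?R")
proof -
  let ?C = "constrained_cost G \<pi> t i x v" and ?D = "decisions_within G t i S R"
  let ?Z = "Z G \<pi> t i x v"
  have lower: "?Z (proj G {i} w) \<le> ?C (w, U, X)" if "(w, U, X) \<in> ?D" for w U X
    using Z_le_constrained_cost[OF assms(1-6) that] .
  have attained: "\<exists>w U X. (w, U, X) \<in> ?D \<and> proj G {i} w = b \<and> ?C (w, U, X) = ?Z b" if b: "b \<in> S" for b
  proof -
    have R: "\<pi> \<tau> i x v \<in> R \<tau> i x v" if "\<tau> \<le> horizon G" "v \<in> ctrl G {1..<i}" for \<tau> x v
      using opt[OF that] by (simp add: is_arg_min_def)
    show ?thesis
      by (rule Z_attained[where R = R, OF assms(1-5) R b]) (use b S in auto)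
  qed
  have inS: "proj G {i} w \<in> S" if "(w, U, X) \<in> ?D" for w U X
    using that by (auto simp: decisions_within_def)
  show ?thesis
  proof
    assume L: ?L
    then have "a \<in> S" and min: "\<And>b. b \<in> S \<Longrightarrow> ?Z a \<le> ?Z b"
      by (auto simp: is_arg_min_def not_less)
    then obtain w U X where y: "(w, U, X) \<in> ?D" "proj G {i} w = a" "?C (w, U, X) = ?Z a"
      using attained by blast
    have "?C (w, U, X) \<le> ?C (w', U', X')" if "(w', U', X') \<in> ?D" for w' U' X'
      using min[OF inS[OF that]] lower[OF that] y(3) by simp
    then have "is_arg_min ?C (\<lambda>y. y \<in> ?D) (w, U, X)"
      using y(1) by (auto simp: is_arg_min_def not_less)
    then show ?R using y L by blast
  next
    assume ?R
    then obtain w U X where y: "proj G {i} w = a" "is_arg_min ?C (\<lambda>y. y \<in> ?D) (w, U, X)"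
      "?C (w, U, X) = c" by blast
    then have yD: "(w, U, X) \<in> ?D" and min: "\<And>y'. y' \<in> ?D \<Longrightarrow> c \<le> ?C y'"
      by (auto simp: is_arg_min_def not_less)
    \<comment> \<open>Some decision attains \<open>?Z b\<close>, and \<open>c\<close> is minimal
      among all decisions.\<close>
    have below: "c \<le> ?Z b" if "b \<in> S" for b
      using attained[OF that] min by metis
    have a: "a \<in> S" using inS[OF yD] y(1) by simp
    \<comment> \<open>Squeezed between \<open>lower\<close> at the given minimizer and
      \<open>below\<close> at \<open>a\<close>.\<close>
    have "?Z a = c" using lower[OF yD] below[OF a] y by simp
    then show ?L using a below by (auto simp: is_arg_min_def not_less)
  qed
qed

section \<open>Specialization to global and local policies\<close>

lemma decisions_within_all:
  "decisions_within G t i (ctrl G {i}) (\<lambda>\<tau> i x v. ctrl G {i}) = decisions G t i"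
  by (auto simp: decisions_within_def proj_in_ctrl)

text \<open>Local optimality gives one open set per time, player, state and observed action; choice
  turns them into a single family. It contains the policy action because a minimizer lies in its
  domain.\<close>

lemma local_stackelberg_neighbourhoods:
  assumes "local_stackelberg G \<pi>"
  obtains R0 where "neighbourhoods G \<pi> R0"
    "\<And>t i x v. t \<le> horizon G \<Longrightarrow> i \<in> players G \<Longrightarrow> v \<in> ctrl G {1..<i} \<Longrightarrow>
      is_arg_min (Z G \<pi> t i x v) (\<lambda>w. w \<in> R0 t i x v) (\<pi> t i x v)"
proof -
  define R0 where "R0 t i x v = (SOME S. openin (top_of_set (ctrl G {i})) S \<and>
    is_arg_min (Z G \<pi> t i x v) (\<lambda>w. w \<in> S) (\<pi> t i x v))" for t i x v
  have R0: "openin (top_of_set (ctrl G {i})) (R0 t i x v) \<and>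
      is_arg_min (Z G \<pi> t i x v) (\<lambda>w. w \<in> R0 t i x v) (\<pi> t i x v)"
    if "t \<le> horizon G" "i \<in> players G" "v \<in> ctrl G {1..<i}" for t i x v
    unfolding R0_def
    by (rule someI_ex) (use assms that in \<open>auto simp: local_stackelberg_def is_local_arg_min_def\<close>)
  show thesis
  proof (rule that)
    show "neighbourhoods G \<pi> R0"
      using R0 unfolding neighbourhoods_def is_arg_min_def by blast
  qed (use R0 in blast)
qed

theorem theorem4p1:
  fixes G :: "('n::finite, 'm::finite) dyn_game" and \<pi> :: "('n, 'm) policy"
  assumes "well_formed G" and "regular_game G"
  shows
    "(global_stackelberg G \<pi> \<longrightarrow>
       (\<forall>t \<le> horizon G. \<forall>i \<in> players G. \<forall>x. \<forall>v \<in> ctrl G {1..<i}. \<forall>w\<^sub>i.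
          is_arg_min (Z G \<pi> t i x v) (\<lambda>w. w \<in> ctrl G {i}) w\<^sub>i \<longleftrightarrow>
          (\<exists>w U X. proj G {i} w = w\<^sub>i \<and>
             is_arg_min (constrained_cost G \<pi> t i x v) (\<lambda>y. y \<in> decisions G t i) (w, U, X)))) \<and>
     (local_stackelberg G \<pi> \<longrightarrow>
       (\<exists>R0. neighbourhoods G \<pi> R0 \<and>
          (\<forall>R. neighbourhoods G \<pi> R \<and> (\<forall>t i x v. R t i x v \<subseteq> R0 t i x v) \<longrightarrow>
            (\<forall>t \<le> horizon G. \<forall>i \<in> players G. \<forall>x. \<forall>v \<in> ctrl G {1..<i}. \<forall>w\<^sub>i c.
               is_local_arg_min (Z G \<pi> t i x v) (ctrl G {i}) w\<^sub>i \<and> Z G \<pi> t i x v w\<^sub>i = c \<longleftrightarrow>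
               (\<exists>S w U X. openin (top_of_set (ctrl G {i})) S \<and> proj G {i} w = w\<^sub>i \<and>
                  is_arg_min (constrained_cost G \<pi> t i x v)
                    (\<lambda>y. y \<in> decisions_within G t i S R) (w, U, X) \<and>
                  constrained_cost G \<pi> t i x v (w, U, X) = c)))))"
proof (intro conjI impI)
  assume glob: "global_stackelberg G \<pi>"
  show "\<forall>t \<le> horizon G. \<forall>i \<in> players G. \<forall>x. \<forall>v \<in> ctrl G {1..<i}. \<forall>w\<^sub>i.
          is_arg_min (Z G \<pi> t i x v) (\<lambda>w. w \<in> ctrl G {i}) w\<^sub>i \<longleftrightarrow>
          (\<exists>w U X. proj G {i} w = w\<^sub>i \<and>
             is_arg_min (constrained_cost G \<pi> t i x v) (\<lambda>y. y \<in> decisions G t i) (w, U, X))"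
  proof (intro allI ballI impI)
    fix t i x v w\<^sub>i
    assume *: "t \<le> horizon G" "i \<in> players G" "v \<in> ctrl G {1..<i}"
    have "is_arg_min (Z G \<pi> \<tau> i x v) (\<lambda>w. w \<in> ctrl G {i}) (\<pi> \<tau> i x v)"
      if "\<tau> \<le> horizon G" "v \<in> ctrl G {1..<i}" for \<tau> x v
      using glob that *(2) by (auto simp: global_stackelberg_def)
    \<comment> \<open>With \<open>S\<close> and \<open>R\<close> the full control space of
      \<open>i\<close>, all decisions are allowed; \<open>c\<close> disappears when taken as the
      value of the minimizer at hand.\<close>
    from arg_min_Z_iff[OF assms(1) global_stackelberg_admissible[OF glob] *,
        where R = "\<lambda>\<tau> i x v. ctrl G {i}", OF this order_refl]
    show "is_arg_min (Z G \<pi> t i x v) (\<lambda>w. w \<in> ctrl G {i}) w\<^sub>i \<longleftrightarrow>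
        (\<exists>w U X. proj G {i} w = w\<^sub>i \<and>
           is_arg_min (constrained_cost G \<pi> t i x v) (\<lambda>y. y \<in> decisions G t i) (w, U, X))"
      unfolding decisions_within_all by blast
  qed
next
  assume loc: "local_stackelberg G \<pi>"
  obtain R0 where nb: "neighbourhoods G \<pi> R0"
    and R0: "\<And>t i x v. t \<le> horizon G \<Longrightarrow> i \<in> players G \<Longrightarrow> v \<in> ctrl G {1..<i} \<Longrightarrow>
      is_arg_min (Z G \<pi> t i x v) (\<lambda>w. w \<in> R0 t i x v) (\<pi> t i x v)"
    using local_stackelberg_neighbourhoods[OF loc] by blast
  have local_iff: "is_local_arg_min (Z G \<pi> t i x v) (ctrl G {i}) w\<^sub>i \<and> Z G \<pi> t i x v w\<^sub>i = c \<longleftrightarrow>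
      (\<exists>S w U X. openin (top_of_set (ctrl G {i})) S \<and> proj G {i} w = w\<^sub>i \<and>
         is_arg_min (constrained_cost G \<pi> t i x v)
           (\<lambda>y. y \<in> decisions_within G t i S R) (w, U, X) \<and>
         constrained_cost G \<pi> t i x v (w, U, X) = c)"
    if R: "neighbourhoods G \<pi> R" "\<forall>t i x v. R t i x v \<subseteq> R0 t i x v"
      and *: "t \<le> horizon G" "i \<in> players G" "v \<in> ctrl G {1..<i}" for R t i x v w\<^sub>i c
  proof -
    \<comment> \<open>A minimizer over \<open>R0\<close> remains one over the smaller
      \<open>R\<close>, which still contains it.\<close>
    have opt: "is_arg_min (Z G \<pi> \<tau> i x v) (\<lambda>w. w \<in> R \<tau> i x v) (\<pi> \<tau> i x v)"
      if "\<tau> \<le> horizon G" "v \<in> ctrl G {1..<i}" for \<tau> x v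
      using R0[OF that(1) *(2) that(2), of x] R that *(2)
      unfolding is_arg_min_def neighbourhoods_def by blast
    \<comment> \<open>The equivalence holds for each fixed open \<open>S\<close>, hence also under
      the existential quantifier over \<open>S\<close> that expresses local minimality.\<close>
    have "is_arg_min (Z G \<pi> t i x v) (\<lambda>w. w \<in> S) w\<^sub>i \<and> Z G \<pi> t i x v w\<^sub>i = c \<longleftrightarrow>
        (\<exists>w U X. proj G {i} w = w\<^sub>i \<and>
           is_arg_min (constrained_cost G \<pi> t i x v)
             (\<lambda>y. y \<in> decisions_within G t i S R) (w, U, X) \<and>
           constrained_cost G \<pi> t i x v (w, U, X) = c)"
      if "openin (top_of_set (ctrl G {i})) S" for S
      using arg_min_Z_iff[OF assms(1) local_stackelberg_admissible[OF loc] *, where R = R,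
          OF opt openin_imp_subset[OF that]] .
    then show ?thesis unfolding is_local_arg_min_def by blast
  qed
  show "\<exists>R0. neighbourhoods G \<pi> R0 \<and>
          (\<forall>R. neighbourhoods G \<pi> R \<and> (\<forall>t i x v. R t i x v \<subseteq> R0 t i x v) \<longrightarrow>
            (\<forall>t \<le> horizon G. \<forall>i \<in> players G. \<forall>x. \<forall>v \<in> ctrl G {1..<i}. \<forall>w\<^sub>i c.
               is_local_arg_min (Z G \<pi> t i x v) (ctrl G {i}) w\<^sub>i \<and> Z G \<pi> t i x v w\<^sub>i = c \<longleftrightarrow>
               (\<exists>S w U X. openin (top_of_set (ctrl G {i})) S \<and> proj G {i} w = w\<^sub>i \<and>
                  is_arg_min (constrained_cost G \<pi> t i x v)
                    (\<lambda>y. y \<in> decisions_within G t i S R) (w, U, X) \<and>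
                  constrained_cost G \<pi> t i x v (w, U, X) = c)))"
    by (intro exI[of _ R0] conjI[OF nb] allI ballI impI) (elim conjE, rule local_iff)
qed

end
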